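(* Let $(X,d)$ and $(Y,\partial)$ be metric spaces and assume that $(X,d)$ is uniformly locally finite. If there exists a uniformly finite-to-one coarse map $f\colon Y\to X$, then \[\mathrm{asydim}(Y,\partial)\leq\mathrm{asydim}(X,d).\] In particular, if $\partial'$ is a metric on $X$ with $d\leq\partial'$, then $\mathrm{asydim}(X,\partial')\leq\mathrm{asydim}(X,d)$.
   Context: A metric space $(X,d)$ is uniformly locally finite if $\sup_{x\in X}|B_r(x)|<\infty$ for all $r>0$. A map $f\colon(Y,\partial)\to(X,d)$ is coarse if $\sup\{d(f(y),f(y'))\mid\partial(y,y')\leq r\}<\infty$ for all $r>0$, and uniformly finite-to-one if $\sup_{x\in X}|f^{-1}(\{x\})|<\infty$. Asymptotic dimension: $\mathrm{asydim}(X,d)\leq n$ if for all $R>0$ there are families $\mathcal{U}_0,\ldots,\mathcal{U}_n$ of subsets of $X$ such that $X=\bigcup_{i\le n}\bigcup_{U\in\mathcal{U}_i}U$, $d(U,U')>R$ for all $i\leq n$ and distinct $U,U'\in\mathcal{U}_i$, and $\sup_{U\in\mathcal{U}_i}\mathrm{diam}(U)<\infty$ for all $i\leq n$; $\mathrm{asydim}(X,d)$ is the least such $n$, or $\infty$ if there is none. *)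

theory Defs
  imports "HOL-Analysis.Analysis"
begin

(* Metric spaces are given by a carrier set and a distance function (locale Metric_space), since
   several metrics on the same set have to be compared. "The supremum of these cardinalities is
   finite" is always spelled out as a common finite bound: card alone is 0 on infinite sets.
   Distances between sets and diameters are taken in ennreal, so that an infimum over the empty
   set is infinity, a supremum over it is 0, and unbounded sets have infinite diameter. *)

definition uniformly_locally_finite :: "'a set \<Rightarrow> ('a \<Rightarrow> 'a \<Rightarrow> real) \<Rightarrow> bool" where
  "uniformly_locally_finite X d \<longleftrightarrow>
     (\<forall>r>0. \<exists>N. \<forall>x\<in>X. finite (Metric_space.mcball X d x r) \<and> card (Metric_space.mcball X d x r) \<le> N)"

definition coarse_map ::
  "'b set \<Rightarrow> ('b \<Rightarrow> 'b \<Rightarrow> real) \<Rightarrow> 'a set \<Rightarrow> ('a \<Rightarrow> 'a \<Rightarrow> real) \<Rightarrow> ('b \<Rightarrow> 'a) \<Rightarrow> bool" where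
  "coarse_map Y e X d f \<longleftrightarrow>
     f \<in> Y \<rightarrow> X \<and> (\<forall>r>0. bdd_above {d (f y) (f y') | y y'. y \<in> Y \<and> y' \<in> Y \<and> e y y' \<le> r})"

definition uniformly_finite_to_one :: "'b set \<Rightarrow> 'a set \<Rightarrow> ('b \<Rightarrow> 'a) \<Rightarrow> bool" where
  "uniformly_finite_to_one Y X f \<longleftrightarrow>
     (\<exists>N. \<forall>x\<in>X. finite {y \<in> Y. f y = x} \<and> card {y \<in> Y. f y = x} \<le> N)"

definition set_distance :: "('a \<Rightarrow> 'a \<Rightarrow> real) \<Rightarrow> 'a set \<Rightarrow> 'a set \<Rightarrow> ennreal" where
  "set_distance d U V = (INF x\<in>U. INF y\<in>V. ennreal (d x y))"

definition set_diameter :: "('a \<Rightarrow> 'a \<Rightarrow> real) \<Rightarrow> 'a set \<Rightarrow> ennreal" where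
  "set_diameter d U = (SUP x\<in>U. SUP y\<in>U. ennreal (d x y))"

definition asydim_le :: "'a set \<Rightarrow> ('a \<Rightarrow> 'a \<Rightarrow> real) \<Rightarrow> nat \<Rightarrow> bool" where
  "asydim_le X d n \<longleftrightarrow>
     (\<forall>R::real. R > 0 \<longrightarrow> (\<exists>\<U> :: nat \<Rightarrow> 'a set set.
        (\<forall>i\<le>n. \<U> i \<subseteq> Pow X) \<and>
        X = (\<Union>i\<le>n. \<Union>U\<in>\<U> i. U) \<and>
        (\<forall>i\<le>n. \<forall>U\<in>\<U> i. \<forall>U'\<in>\<U> i. U \<noteq> U' \<longrightarrow> set_distance d U U' > ennreal R) \<and>
        (\<forall>i\<le>n. (SUP U\<in>\<U> i. set_diameter d U) < \<infinity>)))"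

(* The infimum in enat of a nonempty set is its least element, and Inf {} = \<infinity>. *)
definition asydim :: "'a set \<Rightarrow> ('a \<Rightarrow> 'a \<Rightarrow> real) \<Rightarrow> enat" where
  "asydim X d = Inf {enat n | n. asydim_le X d n}"

end

theory Submission
  imports Defs
begin

text \<open>
  The naive idea is to pull a cover of \<open>X\<close> back along \<open>f\<close>. Since \<open>f\<close> is coarse, it maps
  points of \<open>Y\<close> at distance at most \<open>S\<close> to points at distance at most some \<open>T\<close>, so the
  preimages of \<open>T\<close>-separated sets are \<open>S\<close>-separated. The diameters of the preimages need not be
  bounded, however, because nothing prevents \<open>f\<close> from identifying points that are arbitrarily
  far apart.

  What is bounded is the number of points: a set of diameter at most \<open>D\<close> lies in a ball, so by
  uniform local finiteness it has a bounded number of elements, and since the fibres of \<open>f\<close> have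
  bounded cardinality, so do the preimages of all members of the cover. A set with at most \<open>N\<close>
  points splits into its \<open>S\<close>-chain components, the classes of points that can be joined by
  jumps of length at most \<open>S\<close>. Distinct components are \<open>S\<close>-separated by construction, and a
  shortest chain inside a set of bounded size has a bounded number of jumps, so the components
  have uniformly bounded diameter. Replacing each preimage by its chain components therefore
  gives a cover of \<open>Y\<close> with the same number of families.

  The statement about two metrics on \<open>X\<close> is the case where \<open>f\<close> is the identity, which is coarse
  because \<open>d \<le> e'\<close>, and injective.
\<close>

definition jumps :: "('b \<Rightarrow> 'b \<Rightarrow> real) \<Rightarrow> real \<Rightarrow> 'b set \<Rightarrow> ('b \<times> 'b) set" where
  "jumps e S P = {(y, z). y \<in> P \<and> z \<in> P \<and> e y z \<le> S}"

definition chain_components :: "('b \<Rightarrow> 'b \<Rightarrow> real) \<Rightarrow> real \<Rightarrow> 'b set \<Rightarrow> 'b set set" where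
  "chain_components e S P = P // (jumps e S P)\<^sup>*"

lemma jumps_rtrancl_closed: "(y, z) \<in> (jumps e S P)\<^sup>* \<Longrightarrow> y \<in> P \<Longrightarrow> z \<in> P"
  by (induction rule: rtrancl_induct) (auto simp: jumps_def)

lemma chain_components_subset: "V \<in> chain_components e S P \<Longrightarrow> V \<subseteq> P"
  by (auto simp: chain_components_def quotient_def dest: jumps_rtrancl_closed)

lemma Union_chain_components: "\<Union> (chain_components e S P) = P"
proof
  show "\<Union> (chain_components e S P) \<subseteq> P"
    by (blast dest: chain_components_subset)
  show "P \<subseteq> \<Union> (chain_components e S P)"
    by (auto simp: chain_components_def quotient_def)
qed

context Metric_space
begin

lemma jumps_rtrancl_sym:
  "(y, z) \<in> (jumps d S P)\<^sup>* \<Longrightarrow> (z, y) \<in> (jumps d S P)\<^sup>*"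
proof -
  have "sym (jumps d S P)"
    by (auto simp: sym_def jumps_def commute)
  then show "(y, z) \<in> (jumps d S P)\<^sup>* \<Longrightarrow> (z, y) \<in> (jumps d S P)\<^sup>*"
    by (meson sym_rtrancl symD)
qed

text \<open>A jump of length at most \<open>S\<close> between two components would merge them.\<close>

lemma chain_components_separated:
  assumes V: "V \<in> chain_components d S P" and W: "W \<in> chain_components d S P"
    and "V \<noteq> W" and y: "y \<in> V" and z: "z \<in> W"
  shows "S < d y z"
proof (rule ccontr)
  let ?J = "(jumps d S P)\<^sup>*"
  assume "\<not> S < d y z"
  moreover have "y \<in> P" "z \<in> P"
    using V W y z chain_components_subset by blast+
  ultimately have yz: "(y, z) \<in> ?J"
    by (auto simp: jumps_def)
  obtain v w where v: "V = ?J `` {v}" and w: "W = ?J `` {w}"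
    using V W by (auto simp: chain_components_def quotient_def)
  have vw: "(v, w) \<in> ?J"
    using v w y z yz by (blast intro: rtrancl_trans jumps_rtrancl_sym)
  then have "V = W"
    unfolding v w by (blast intro: rtrancl_trans dest: jumps_rtrancl_sym)
  with \<open>V \<noteq> W\<close> show False ..
qed

lemma chain_length_bound:
  assumes "P \<subseteq> M" "y \<in> P" "(y, z) \<in> jumps d S P ^^ n"
  shows "d y z \<le> real n * S"
  using assms(3)
proof (induction n arbitrary: z)
  case 0
  then show ?case using assms by auto
next
  case (Suc n)
  then obtain x where x: "(y, x) \<in> jumps d S P ^^ n" "(x, z) \<in> jumps d S P"
    by auto
  then have "x \<in> P" "z \<in> P" "d x z \<le> S"
    by (auto simp: jumps_def)
  moreover have "d y z \<le> d y x + d x z"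
    using assms \<open>x \<in> P\<close> \<open>z \<in> P\<close> by (blast intro: triangle)
  ultimately show ?case
    using Suc.IH[OF x(1)] by (simp add: algebra_simps)
qed

text \<open>
  A shortest chain repeats no jump, and there are at most \<open>(card P)\<^sup>2\<close> jumps. The bound is far from
  sharp, but depends only on \<open>S\<close> and the cardinality of \<open>P\<close>, which is all that matters.
\<close>

lemma chain_components_bounded:
  assumes "P \<subseteq> M" "finite P" "0 \<le> S" and V: "V \<in> chain_components d S P"
    and y: "y \<in> V" and z: "z \<in> V"
  shows "d y z \<le> real ((card P)\<^sup>2) * S"
proof -
  let ?J = "jumps d S P"
  have sub: "?J \<subseteq> P \<times> P"
    by (auto simp: jumps_def)
  then have fin: "finite ?J"
    using \<open>finite P\<close> by (meson finite_SigmaI finite_subset)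
  have card: "card ?J \<le> (card P)\<^sup>2"
    using card_mono[OF _ sub] \<open>finite P\<close> by (simp add: card_cartesian_product power2_eq_square)
  have "(y, z) \<in> ?J\<^sup>*"
    using V y z by (auto simp: chain_components_def quotient_def
        intro: rtrancl_trans dest: jumps_rtrancl_sym)
  then obtain n where n: "n \<le> card ?J" "(y, z) \<in> ?J ^^ n"
    using rtrancl_finite_eq_relpow[OF fin] by auto
  have "y \<in> P"
    using V y chain_components_subset by blast
  then have "d y z \<le> real n * S"
    using chain_length_bound n(2) \<open>P \<subseteq> M\<close> by blast
  also have "\<dots> \<le> real ((card P)\<^sup>2) * S"
    using n(1) card \<open>0 \<le> S\<close> by (intro mult_right_mono) linarith+
  finally show ?thesis .
qed

end

lemma set_distance_le: "x \<in> U \<Longrightarrow> y \<in> V \<Longrightarrow> set_distance d U V \<le> ennreal (d x y)"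
  unfolding set_distance_def by (meson INF_lower2 INF_lower)

lemma le_set_distance:
  "(\<And>x y. x \<in> U \<Longrightarrow> y \<in> V \<Longrightarrow> r \<le> d x y) \<Longrightarrow> ennreal r \<le> set_distance d U V"
  unfolding set_distance_def by (intro INF_greatest ennreal_leI)

lemma le_set_diameter: "x \<in> U \<Longrightarrow> y \<in> U \<Longrightarrow> ennreal (d x y) \<le> set_diameter d U"
  unfolding set_diameter_def by (meson SUP_upper2 SUP_upper)

lemma set_diameter_le:
  "(\<And>x y. x \<in> U \<Longrightarrow> y \<in> U \<Longrightarrow> d x y \<le> r) \<Longrightarrow> set_diameter d U \<le> ennreal r"
  unfolding set_diameter_def by (intro SUP_least ennreal_leI)

lemma uniformly_bounded_preimage_card:
  assumes "Metric_space X d" "uniformly_locally_finite X d" "uniformly_finite_to_one Y X f"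
    and "\<A> \<subseteq> Pow X" and diam: "(SUP U\<in>\<A>. set_diameter d U) < \<infinity>"
  obtains N where "\<And>U. U \<in> \<A> \<Longrightarrow> finite {y \<in> Y. f y \<in> U} \<and> card {y \<in> Y. f y \<in> U} \<le> N"
proof -
  interpret X: Metric_space X d by fact
  obtain D where D: "0 \<le> D" "(SUP U\<in>\<A>. set_diameter d U) = ennreal D"
    using diam by (cases "SUP U\<in>\<A>. set_diameter d U") auto
  have dist: "d x y \<le> D" if "U \<in> \<A>" "x \<in> U" "y \<in> U" for U x y
  proof -
    have "ennreal (d x y) \<le> set_diameter d U"
      using that by (intro le_set_diameter)
    also have "\<dots> \<le> ennreal D"
      using that by (metis D(2) SUP_upper)
    finally show ?thesis
      using D(1) by simp
  qed
  \<comment> \<open>The radius of a ball has to be positive, while \<open>D\<close> may vanish.\<close>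
  obtain K where K: "\<And>x. x \<in> X \<Longrightarrow> finite (X.mcball x (D + 1)) \<and> card (X.mcball x (D + 1)) \<le> K"
    using assms(2) D(1) unfolding uniformly_locally_finite_def by (metis add_nonneg_pos zero_less_one)
  obtain L where L: "\<And>x. x \<in> X \<Longrightarrow> finite {y \<in> Y. f y = x} \<and> card {y \<in> Y. f y = x} \<le> L"
    using assms(3) unfolding uniformly_finite_to_one_def by blast
  have "finite {y \<in> Y. f y \<in> U} \<and> card {y \<in> Y. f y \<in> U} \<le> K * L" if U: "U \<in> \<A>" for U
  proof (cases "U = {}")
    case False
    then obtain x where x: "x \<in> U"
      by blast
    have "U \<subseteq> X"
      using U \<open>\<A> \<subseteq> Pow X\<close> by blast
    then have "U \<subseteq> X.mcball x (D + 1)"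
      using dist[OF U x] x by (fastforce simp: X.in_mcball)
    moreover have "x \<in> X"
      using x \<open>U \<subseteq> X\<close> by blast
    ultimately have finU: "finite U" and cardU: "card U \<le> K"
      using K by (meson finite_subset card_mono order_trans)+
    have eq: "{y \<in> Y. f y \<in> U} = (\<Union>u\<in>U. {y \<in> Y. f y = u})"
      by blast
    have "card {y \<in> Y. f y \<in> U} \<le> (\<Sum>u\<in>U. card {y \<in> Y. f y = u})"
      unfolding eq by (rule card_UN_le[OF finU])
    also have "\<dots> \<le> card U * L"
      using L \<open>U \<subseteq> X\<close> sum_bounded_above[of U "\<lambda>u. card {y \<in> Y. f y = u}" L] by auto
    also have "\<dots> \<le> K * L"
      using cardU by simp
    finally show ?thesis
      unfolding eq using finU L \<open>U \<subseteq> X\<close> by (metis (no_types, lifting) finite_UN_I subsetD)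
  qed simp
  then show thesis
    by (rule that)
qed

text \<open>
  The cover of \<open>Y\<close> consists of the chain components of the preimages of a cover of \<open>X\<close>. Components
  of the same preimage are separated by construction, components of different preimages because \<open>f\<close>
  is coarse.
\<close>

lemma asydim_le_coarse_finite_to_one:
  assumes "Metric_space X d" "Metric_space Y e" "uniformly_locally_finite X d"
    and f: "coarse_map Y e X d f" and fib: "uniformly_finite_to_one Y X f"
    and asydim: "asydim_le X d n"
  shows "asydim_le Y e n"
  unfolding asydim_le_def
proof (intro allI impI)
  interpret Y: Metric_space Y e by fact
  fix R :: real
  assume "R > 0"
  \<comment> \<open>The distance of two sets is an infimum, so its strict lower bound \<open>R\<close> needs some slack.\<close>
  define S where "S = R + 1"
  have S: "S > 0" "R < S"
    using \<open>R > 0\<close> by (auto simp: S_def)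
  have "bdd_above {d (f y) (f y') |y y'. y \<in> Y \<and> y' \<in> Y \<and> e y y' \<le> S}"
    using f S(1) unfolding coarse_map_def by simp
  then obtain T0 where T0: "\<And>y y'. y \<in> Y \<Longrightarrow> y' \<in> Y \<Longrightarrow> e y y' \<le> S \<Longrightarrow> d (f y) (f y') \<le> T0"
    unfolding bdd_above_def by blast
  define T where "T = max T0 1"
  have T: "T > 0" "\<And>y y'. y \<in> Y \<Longrightarrow> y' \<in> Y \<Longrightarrow> e y y' \<le> S \<Longrightarrow> d (f y) (f y') \<le> T"
    using T0 by (auto simp: T_def intro: max.coboundedI1)
  obtain \<U> :: "nat \<Rightarrow> 'a set set" where
    sub: "\<And>i. i \<le> n \<Longrightarrow> \<U> i \<subseteq> Pow X" and cover: "X = (\<Union>i\<le>n. \<Union>U\<in>\<U> i. U)"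
    and sep: "\<And>i U U'. i \<le> n \<Longrightarrow> U \<in> \<U> i \<Longrightarrow> U' \<in> \<U> i \<Longrightarrow> U \<noteq> U' \<Longrightarrow>
               set_distance d U U' > ennreal T"
    and diam: "\<And>i. i \<le> n \<Longrightarrow> (SUP U\<in>\<U> i. set_diameter d U) < \<infinity>"
    using asydim T(1) unfolding asydim_le_def by metis
  define pre where "pre U = {y \<in> Y. f y \<in> U}" for U
  define \<V> where "\<V> i = (\<Union>U\<in>\<U> i. chain_components e S (pre U))" for i
  have "\<V> i \<subseteq> Pow Y" for i
    unfolding \<V>_def pre_def by (blast dest: chain_components_subset)
  moreover have "Y = (\<Union>i\<le>n. \<Union>V\<in>\<V> i. V)"
  proof -
    have "(\<Union>i\<le>n. \<Union>V\<in>\<V> i. V) = (\<Union>i\<le>n. \<Union>U\<in>\<U> i. \<Union> (chain_components e S (pre U)))"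
      unfolding \<V>_def by blast
    also have "\<dots> = (\<Union>i\<le>n. \<Union>U\<in>\<U> i. pre U)"
      by (simp only: Union_chain_components)
    also have "\<dots> = {y \<in> Y. f y \<in> (\<Union>i\<le>n. \<Union>U\<in>\<U> i. U)}"
      unfolding pre_def by blast
    also have "\<dots> = Y"
      using f unfolding cover[symmetric] coarse_map_def by blast
    finally show ?thesis ..
  qed
  moreover have "set_distance e V V' > ennreal R"
    if i: "i \<le> n" and V: "V \<in> \<V> i" and V': "V' \<in> \<V> i" and "V \<noteq> V'" for i V V'
  proof -
    obtain U U' where U: "U \<in> \<U> i" "V \<in> chain_components e S (pre U)"
      and U': "U' \<in> \<U> i" "V' \<in> chain_components e S (pre U')"
      using V V' unfolding \<V>_def by blast
    have "S \<le> e y y'" if y: "y \<in> V" "y' \<in> V'" for y y'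
    proof (cases "U = U'")
      case True
      then show ?thesis
        using Y.chain_components_separated U(2) U'(2) \<open>V \<noteq> V'\<close> y by (metis less_imp_le)
    next
      case False
      have pre: "y \<in> Y" "f y \<in> U" "y' \<in> Y" "f y' \<in> U'"
        using chain_components_subset U(2) U'(2) y unfolding pre_def by blast+
      have "ennreal T < ennreal (d (f y) (f y'))"
        using sep[OF i U(1) U'(1) False] set_distance_le[OF pre(2,4)] by (rule less_le_trans)
      then have "T < d (f y) (f y')"
        using T(1) by (simp add: ennreal_less_iff)
      then show ?thesis
        using T(2)[OF pre(1,3)] by linarith
    qed
    then have "ennreal S \<le> set_distance e V V'"
      by (rule le_set_distance)
    moreover have "ennreal R < ennreal S"
      using S(2) \<open>R > 0\<close> by (simp add: ennreal_less_iff)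
    ultimately show ?thesis
      by (rule less_le_trans[rotated])
  qed
  moreover have "(SUP V\<in>\<V> i. set_diameter e V) < \<infinity>" if i: "i \<le> n" for i
  proof -
    obtain N where N: "\<And>U. U \<in> \<U> i \<Longrightarrow> finite (pre U) \<and> card (pre U) \<le> N"
      using uniformly_bounded_preimage_card[OF assms(1,3) fib sub[OF i] diam[OF i]]
      unfolding pre_def by blast
    have "set_diameter e V \<le> ennreal (real (N\<^sup>2) * S)" if "V \<in> \<V> i" for V
    proof (rule set_diameter_le)
      fix y z
      assume yz: "y \<in> V" "z \<in> V"
      obtain U where U: "U \<in> \<U> i" "V \<in> chain_components e S (pre U)"
        using \<open>V \<in> \<V> i\<close> unfolding \<V>_def by blast
      have "e y z \<le> real ((card (pre U))\<^sup>2) * S"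
        using N[OF U(1)] S(1) U(2) yz
        by (intro Y.chain_components_bounded) (auto simp: pre_def)
      also have "\<dots> \<le> real (N\<^sup>2) * S"
        using N[OF U(1)] S(1) by (intro mult_right_mono of_nat_mono power_mono) auto
      finally show "e y z \<le> real (N\<^sup>2) * S" .
    qed
    then have "(SUP V\<in>\<V> i. set_diameter e V) \<le> ennreal (real (N\<^sup>2) * S)"
      by (rule SUP_least)
    then show ?thesis
      using ennreal_less_top by (metis infinity_ennreal_def le_less_trans)
  qed
  ultimately have "(\<forall>i\<le>n. \<V> i \<subseteq> Pow Y) \<and>
        Y = (\<Union>i\<le>n. \<Union>V\<in>\<V> i. V) \<and>
        (\<forall>i\<le>n. \<forall>V\<in>\<V> i. \<forall>V'\<in>\<V> i. V \<noteq> V' \<longrightarrow> set_distance e V V' > ennreal R) \<and>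
        (\<forall>i\<le>n. (SUP V\<in>\<V> i. set_diameter e V) < \<infinity>)"
    by (intro conjI allI ballI impI)
  then show "\<exists>\<V> :: nat \<Rightarrow> 'b set set.
        (\<forall>i\<le>n. \<V> i \<subseteq> Pow Y) \<and>
        Y = (\<Union>i\<le>n. \<Union>V\<in>\<V> i. V) \<and>
        (\<forall>i\<le>n. \<forall>V\<in>\<V> i. \<forall>V'\<in>\<V> i. V \<noteq> V' \<longrightarrow> set_distance e V V' > ennreal R) \<and>
        (\<forall>i\<le>n. (SUP V\<in>\<V> i. set_diameter e V) < \<infinity>)"
    by (rule exI[of _ \<V>])
qed

lemma asydim_mono_coarse_finite_to_one:
  assumes "Metric_space X d" "Metric_space Y e" "uniformly_locally_finite X d"
    and "coarse_map Y e X d f" "uniformly_finite_to_one Y X f"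
  shows "asydim Y e \<le> asydim X d"
  unfolding asydim_def
  using asydim_le_coarse_finite_to_one[OF assms] by (intro Inf_superset_mono) blast

lemma coarse_map_id:
  assumes "\<And>x y. x \<in> X \<Longrightarrow> y \<in> X \<Longrightarrow> d x y \<le> e x y"
  shows "coarse_map X e X d (\<lambda>x. x)"
proof -
  have "\<forall>a\<in>{d x y |x y. x \<in> X \<and> y \<in> X \<and> e x y \<le> r}. a \<le> r" for r
    using assms by (auto intro: order_trans)
  then show ?thesis
    unfolding coarse_map_def bdd_above_def by blast
qed

lemma uniformly_finite_to_one_id: "uniformly_finite_to_one X X (\<lambda>x. x)"
proof -
  have "finite {y \<in> X. y = x} \<and> card {y \<in> X. y = x} \<le> 1" if "x \<in> X" for x
  proof -
    have "{y \<in> X. y = x} = {x}"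
      using that by blast
    then show ?thesis
      by simp
  qed
  then show ?thesis
    unfolding uniformly_finite_to_one_def by blast
qed

theorem proposition2p5:
  fixes X :: "'a set" and d :: "'a \<Rightarrow> 'a \<Rightarrow> real"
    and Y :: "'b set" and e :: "'b \<Rightarrow> 'b \<Rightarrow> real"
  assumes "Metric_space X d"
    and "Metric_space Y e"
    and "uniformly_locally_finite X d"
  shows "((\<exists>f. coarse_map Y e X d f \<and> uniformly_finite_to_one Y X f) \<longrightarrow> asydim Y e \<le> asydim X d) \<and>
    (\<forall>e'. Metric_space X e' \<and> (\<forall>x\<in>X. \<forall>y\<in>X. d x y \<le> e' x y) \<longrightarrow> asydim X e' \<le> asydim X d)"
proof (intro conjI impI allI; elim exE conjE)
  fix f
  assume "coarse_map Y e X d f" "uniformly_finite_to_one Y X f"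
  then show "asydim Y e \<le> asydim X d"
    by (rule asydim_mono_coarse_finite_to_one[OF assms])
next
  fix e'
  assume "Metric_space X e'" and "\<forall>x\<in>X. \<forall>y\<in>X. d x y \<le> e' x y"
  then show "asydim X e' \<le> asydim X d"
    by (intro asydim_mono_coarse_finite_to_one[OF assms(1) _ assms(3) coarse_map_id
          uniformly_finite_to_one_id]) auto
qed

end
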